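(* Let $c:\mathbb{R}^n\times\mathbb{R}^m\to\mathbb{R}$ be Lipschitz continuous, with $c(\cdot,y)$ convex for every $y\in\mathbb{R}^m$ and $c(x,\cdot)$ concave for every $x\in\mathbb{R}^n$. Let $g:\mathbb{R}^n\to\mathbb{R}^{\hat n}$ and $h:\mathbb{R}^m\to\mathbb{R}^{\hat m}$ be continuously differentiable, let $X\subset\mathbb{R}^n$ and $Y\subset\mathbb{R}^m$ be convex and compact, and let $\lambda_1,\lambda_2>0$. Then any saddle point of $\min_{x\in X}\max_{y\in Y}c(x,y)$ is a local saddle point of $$\min_{x\in X}\max_{y\in Y} f(x,y):=c(x,y)+\lambda_1\|g(x)_+\|_0-\lambda_2\|h(y)_+\|_0.$$
   Context: For $a\in\mathbb{R}^k$, $\|a_+\|_0$ denotes the number of indices $i\in\{1,\dots,k\}$ with $a_i>0$. $\mathbf{B}(z,\delta)$ is the closed ball with center $z$ and radius $\delta$. For a function $F:X\times Y\to\mathbb{R}$, a point $(x^*,y^* )\in X\times Y$ is a saddle point of $\min_{x\in X}\max_{y\in Y}F(x,y)$ if $F(x^*,y)\le F(x^*,y^* )\le F(x,y^* )$ for all $(x,y)\in X\times Y$. It is a local saddle point if there is a $\delta>0$ such that these inequalities hold for all $x\in X\cap\mathbf{B}(x^*,\delta)$ and $y\in Y\cap\mathbf{B}(y^*,\delta)$. *)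

theory Defs
  imports "HOL-Analysis.Analysis"
begin

text \<open>The quantity \<open>\<parallel>a\<^sub>+\<parallel>\<^sub>0\<close>.\<close>

definition pos_part_l0 :: "real ^ 'k \<Rightarrow> nat" where
  "pos_part_l0 a = card {i. a $ i > 0}"

text \<open>The first argument of \<open>F\<close> is minimised and the second is maximised.\<close>

definition saddle_point ::
  "'a set \<Rightarrow> 'b set \<Rightarrow> ('a \<Rightarrow> 'b \<Rightarrow> real) \<Rightarrow> 'a \<Rightarrow> 'b \<Rightarrow> bool" where
  "saddle_point X Y F xs ys \<longleftrightarrow>
     xs \<in> X \<and> ys \<in> Y \<and>
     (\<forall>x\<in>X. \<forall>y\<in>Y. F xs y \<le> F xs ys \<and> F xs ys \<le> F x ys)"

definition local_saddle_point ::
  "'a::metric_space set \<Rightarrow> 'b::metric_space set \<Rightarrow> ('a \<Rightarrow> 'b \<Rightarrow> real) \<Rightarrow> 'a \<Rightarrow> 'b \<Rightarrow> bool" where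
  "local_saddle_point X Y F xs ys \<longleftrightarrow>
     xs \<in> X \<and> ys \<in> Y \<and>
     (\<exists>\<delta>>0. \<forall>x \<in> X \<inter> cball xs \<delta>. \<forall>y \<in> Y \<inter> cball ys \<delta>.
        F xs y \<le> F xs ys \<and> F xs ys \<le> F x ys)"

text \<open>Continuity of the derivative is with respect to the operator norm.\<close>

definition continuously_differentiable ::
  "('a::real_normed_vector \<Rightarrow> 'b::real_normed_vector) \<Rightarrow> bool" where
  "continuously_differentiable f \<longleftrightarrow>
     (\<exists>f' :: 'a \<Rightarrow> 'a \<Rightarrow>\<^sub>L 'b.
        (\<forall>x. (f has_derivative blinfun_apply (f' x)) (at x)) \<and> continuous_on UNIV f')"

end

theory Submission
  imports Defs
begin

text \<open>
  The function \<open>a \<mapsto> \<parallel>a\<^sub>+\<parallel>\<^sub>0\<close> is lower semicontinuous and integer valued: strict positivity of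
  a coordinate survives small perturbations, so the number of positive coordinates cannot drop
  nearby. Hence, close to \<open>(x\<^sup>*, y\<^sup>*)\<close>, the penalty \<open>\<parallel>g(x)\<^sub>+\<parallel>\<^sub>0\<close> is at least its value at \<open>x\<^sup>*\<close>, which
  can only hurt the minimising player, and \<open>\<parallel>h(y)\<^sub>+\<parallel>\<^sub>0\<close> is at least its value at \<open>y\<^sup>*\<close>, which, being
  subtracted, can only hurt the maximising player. Since each penalty depends on the variable of one
  player only, it cancels when that variable is held fixed, and adding the penalties preserves
  the saddle inequalities of \<open>c\<close> on a small enough ball.
\<close>

text \<open>
  Lower semicontinuity without any loss of value: the finitely many coordinates that are positive
  at \<open>z\<close> stay positive on a common neighbourhood, while zero coordinates may become positive.
\<close>

lemma eventually_pos_part_l0_ge: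
  fixes f :: "'a::t2_space \<Rightarrow> real ^ 'k"
  assumes "isCont f z"
  shows "\<forall>\<^sub>F x in nhds z. pos_part_l0 (f z) \<le> pos_part_l0 (f x)"
proof -
  have "\<forall>\<^sub>F x in nhds z. f z $ i > 0 \<longrightarrow> f x $ i > 0" for i
  proof (cases "f z $ i > 0")
    case True
    have "((\<lambda>x. f x $ i) \<longlongrightarrow> f z $ i) (nhds z)"
      using assms by (intro tendsto_vec_nth) (simp add: continuous_at tendsto_at_iff_tendsto_nhds)
    then show ?thesis
      using order_tendstoD(1)[OF _ True] by (auto elim: eventually_mono)
  qed simp
  then have "\<forall>\<^sub>F x in nhds z. \<forall>i. f z $ i > 0 \<longrightarrow> f x $ i > 0"
    by (rule eventually_all_finite)
  then show ?thesis
    unfolding pos_part_l0_def by (rule eventually_mono) (auto intro: card_mono)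
qed

lemma pos_part_l0_ge_on_cball:
  fixes f :: "'a::metric_space \<Rightarrow> real ^ 'k"
  assumes "isCont f z"
  obtains \<delta> where "\<delta> > 0" "\<And>x. x \<in> cball z \<delta> \<Longrightarrow> pos_part_l0 (f z) \<le> pos_part_l0 (f x)"
  using eventually_pos_part_l0_ge[OF assms]
  unfolding eventually_nhds_metric_le by (auto simp: dist_commute)

lemma continuously_differentiable_imp_isCont:
  "continuously_differentiable f \<Longrightarrow> isCont f x"
  unfolding continuously_differentiable_def by (blast intro: has_derivative_continuous)

text \<open>
  The mechanism by which a saddle point survives as a local one: any functions \<open>p\<close> and \<open>q\<close> with
  local minima at the two components may be added to and subtracted from the payoff.
\<close>

lemma saddle_point_add_separable_penalty:
  fixes X :: "'a::metric_space set" and Y :: "'b::metric_space set"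
  assumes "saddle_point X Y F xs ys"
    and "\<delta> > 0" and p: "\<And>x. x \<in> cball xs \<delta> \<Longrightarrow> p xs \<le> p x"
    and "\<epsilon> > 0" and q: "\<And>y. y \<in> cball ys \<epsilon> \<Longrightarrow> q ys \<le> q y"
  shows "local_saddle_point X Y (\<lambda>x y. F x y + p x - q y) xs ys"
  unfolding local_saddle_point_def
proof (intro conjI exI ballI)
  show "xs \<in> X" "ys \<in> Y" "min \<delta> \<epsilon> > 0"
    using assms by (auto simp: saddle_point_def)
next
  fix x y
  assume x: "x \<in> X \<inter> cball xs (min \<delta> \<epsilon>)" and y: "y \<in> Y \<inter> cball ys (min \<delta> \<epsilon>)"
  have "F xs y \<le> F xs ys" "F xs ys \<le> F x ys"
    using assms(1) x y by (auto simp: saddle_point_def)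
  moreover have "p xs \<le> p x" "q ys \<le> q y"
    using x y by (auto intro: p q)
  ultimately show "F xs y + p xs - q y \<le> F xs ys + p xs - q ys"
    and "F xs ys + p xs - q ys \<le> F x ys + p x - q ys"
    by linarith+
qed

theorem proposition2p2:
  fixes c :: "real ^ 'n \<Rightarrow> real ^ 'm \<Rightarrow> real"
    and g :: "real ^ 'n \<Rightarrow> real ^ 'nh"
    and h :: "real ^ 'm \<Rightarrow> real ^ 'mh"
    and X :: "(real ^ 'n) set" and Y :: "(real ^ 'm) set"
    and lam1 lam2 :: real
    and xs :: "real ^ 'n" and ys :: "real ^ 'm"
  assumes "\<exists>L. L-lipschitz_on UNIV (\<lambda>(x, y). c x y)"
    and "\<And>y. convex_on UNIV (\<lambda>x. c x y)"
    and "\<And>x. concave_on UNIV (\<lambda>y. c x y)"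
    and "continuously_differentiable g"
    and "continuously_differentiable h"
    and "convex X" and "compact X"
    and "convex Y" and "compact Y"
    and "lam1 > 0" and "lam2 > 0"
    and "saddle_point X Y c xs ys"
  shows "local_saddle_point X Y
           (\<lambda>x y. c x y + lam1 * real (pos_part_l0 (g x)) - lam2 * real (pos_part_l0 (h y))) xs ys"
proof -
  obtain \<delta> where \<delta>: "\<delta> > 0"
      "\<And>x. x \<in> cball xs \<delta> \<Longrightarrow> pos_part_l0 (g xs) \<le> pos_part_l0 (g x)"
    using pos_part_l0_ge_on_cball[OF continuously_differentiable_imp_isCont]
      \<open>continuously_differentiable g\<close> by metis
  obtain \<epsilon> where \<epsilon>: "\<epsilon> > 0"
      "\<And>y. y \<in> cball ys \<epsilon> \<Longrightarrow> pos_part_l0 (h ys) \<le> pos_part_l0 (h y)"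
    using pos_part_l0_ge_on_cball[OF continuously_differentiable_imp_isCont]
      \<open>continuously_differentiable h\<close> by metis
  show ?thesis
    using \<open>saddle_point X Y c xs ys\<close> \<delta> \<epsilon> \<open>lam1 > 0\<close> \<open>lam2 > 0\<close>
    by (intro saddle_point_add_separable_penalty[where \<delta> = \<delta> and \<epsilon> = \<epsilon>]) auto
qed

end
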